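(* Let $k\ge 3$ and $n>k$ be integers, and let $F$ be the distribution function of a random variable $X$ with values in $[0,1]$. Assume that $F$ is $k-2$ times continuously differentiable and that its density $f:=F'$ satisfies $f(x)>0$ for all $x\in[0,1]$. Let $Q:=F^{-1}$ be the quantile function. Assume that $\beta:[0,1]\to\mathbb{R}^+$ is an increasing function and that $\beta(X)$ has an increasing distribution function with a continuous density. Denote $\tilde x=F(x)$ and $\gamma(\tilde x):=Q(\tilde x)\,\tilde x^{\,n-2}$. Then the equation $$\int_{0}^x [x-\beta(y)]\,F(y)^{n-k}\,[F(x)-F(y)]^{k-3}f(y)\,dy = 0\qquad\text{for all } x\in[0,1]$$ has a unique solution, given by $$\beta(x)=\frac{\gamma^{(k-2)}(\tilde x)}{(k-2)!\binom{n-2}{k-2}F(x)^{n-k}},$$ where the superscript $(t)$ denotes the derivative of order $t$ with respect to $\tilde x$.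
   Context: The unknown in the equation is the function $\beta$. $\mathbb{R}^+=[0,\infty)$. The equation characterizes the increasing symmetric equilibrium bid functions $\beta$ of the $k$th price auction (the highest bidder wins and pays the $k$th highest bid) with $n$ bidders whose valuations are i.i.d. with distribution function $F$. *)

theory Defs
  imports "HOL-Probability.Probability"
begin

text \<open>
  Derivatives are taken relative to the interval: a distribution function on [0,1] with positive
  density at the endpoints is not differentiable there as a function on the whole real line, so
  derivatives at 0 and 1 have to be one-sided.
\<close>

definition deriv_on :: "real set \<Rightarrow> (real \<Rightarrow> real) \<Rightarrow> real \<Rightarrow> real" where
  "deriv_on S g x = vector_derivative g (at x within S)"

definition higher_deriv_on :: "real set \<Rightarrow> nat \<Rightarrow> (real \<Rightarrow> real) \<Rightarrow> real \<Rightarrow> real" where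
  "higher_deriv_on S m = deriv_on S ^^ m"

definition cont_diff_on :: "nat \<Rightarrow> real set \<Rightarrow> (real \<Rightarrow> real) \<Rightarrow> bool" where
  "cont_diff_on m S g \<longleftrightarrow>
     (\<forall>j<m. higher_deriv_on S j g differentiable_on S) \<and>
     continuous_on S (higher_deriv_on S m g)"

definition quantile :: "(real \<Rightarrow> real) \<Rightarrow> real \<Rightarrow> real" where
  "quantile F = inv_into {0..1} F"

definition bid_gamma :: "nat \<Rightarrow> (real \<Rightarrow> real) \<Rightarrow> real \<Rightarrow> real" where
  "bid_gamma n F p = quantile F p * p ^ (n - 2)"

text \<open>
  At \<open>x = 0\<close> the quotient below is 0/0, since \<open>F 0 = 0\<close> and \<open>n > k\<close>. The HOL value 0 agrees with
  the limit of the quotient as \<open>x\<close> tends to 0 from the right.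
\<close>

definition bid_formula :: "nat \<Rightarrow> nat \<Rightarrow> (real \<Rightarrow> real) \<Rightarrow> real \<Rightarrow> real" where
  "bid_formula n k F x =
     higher_deriv_on {0..1} (k - 2) (bid_gamma n F) (F x) /
     (fact (k - 2) * real ((n - 2) choose (k - 2)) * F x ^ (n - k))"

text \<open>\<open>has_integral 0\<close> says that the integral exists and is 0.\<close>

definition kth_price_equation ::
    "nat \<Rightarrow> nat \<Rightarrow> (real \<Rightarrow> real) \<Rightarrow> (real \<Rightarrow> real) \<Rightarrow> (real \<Rightarrow> real) \<Rightarrow> bool" where
  "kth_price_equation n k F f \<beta> \<longleftrightarrow>
     (\<forall>x\<in>{0..1}.
        ((\<lambda>y. (x - \<beta> y) * F y ^ (n - k) * (F x - F y) ^ (k - 3) * f y) has_integral 0) {0..x})"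

text \<open>
  Bids lie in the interval from \<open>\<beta> 0\<close> to \<open>\<beta> 1\<close>. A distribution function cannot be strictly
  increasing outside it, and the density of \<open>\<beta>(X)\<close> may jump at its ends (as that of \<open>X\<close>
  itself does at 0 and 1); so the distribution function is required to be strictly increasing on
  this interval, and the density to be continuous in its interior.
\<close>

definition admissible_bid :: "'a measure \<Rightarrow> ('a \<Rightarrow> real) \<Rightarrow> (real \<Rightarrow> real) \<Rightarrow> bool" where
  "admissible_bid M X \<beta> \<longleftrightarrow>
     \<beta> \<in> {0..1} \<rightarrow> {0..} \<and>
     strict_mono_on {0..1} \<beta> \<and>
     strict_mono_on {\<beta> 0..\<beta> 1} (cdf (distr M borel (\<lambda>\<omega>. \<beta> (X \<omega>)))) \<and>
     (\<exists>g. (\<forall>y. 0 \<le> g y) \<and> continuous_on {\<beta> 0<..<\<beta> 1} g \<and>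
          distributed M lborel (\<lambda>\<omega>. \<beta> (X \<omega>)) (\<lambda>y. ennreal (g y)))"

end

theory Submission
  imports Defs
begin

text \<open>
  In the variable \<open>p = F y\<close>, with \<open>s = F x\<close>, the equation compares a moment of \<open>p ^ (n - k)\<close>
  against the kernel \<open>(s - p) ^ (k - 3)\<close> with the same moment of \<open>\<beta> (Q p) * p ^ (n - k)\<close>. Since \<open>\<gamma>\<close>
  and \<open>p ^ (n - 2)\<close> vanish at \<open>0\<close> together with their derivatives of order at most \<open>k - 3\<close>, Taylor's
  formula with integral remainder evaluates such moments of their derivatives of order \<open>k - 2\<close>:
  they are \<open>\<gamma> s = x * s ^ (n - 2)\<close> and \<open>s ^ (n - 2)\<close>, up to the same factor. So the formula solves
  the equation.

  Conversely, the difference of two solutions solves a homogeneous Volterra equation of the first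
  kind, so its weighted integral over every \<open>{0..x}\<close> is \<open>0\<close>. An increasing \<open>\<beta>\<close> is continuous off a
  countable set, hence agrees with the formula there, and by monotonicity and the continuity of
  the formula on all of \<open>{0<..<1}\<close>. At \<open>0\<close> the limit of the formula is \<open>0\<close>, which pins down
  \<open>\<beta> 0 \<ge> 0\<close>; at \<open>1\<close> a jump of \<open>\<beta>\<close> would make the distribution function of the bids constant on an
  interval.
\<close>

subsection \<open>Calculus of continuously differentiable functions on an interval\<close>

text \<open>Every point of a nondegenerate interval is a limit point of it, so the derivative within
  it is unique even at the ends.\<close>

lemma deriv_on_eq:
  assumes "a < b" "x \<in> {a..b}" "(g has_real_derivative d) (at x within {a..b})"
  shows "deriv_on {a..b} g x = d"
  using assms unfolding deriv_on_def has_real_derivative_iff_has_vector_derivative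
  by (rule vector_derivative_within_closed_interval)

lemma deriv_on_cong:
  assumes "\<And>x. x \<in> S \<Longrightarrow> g x = h x" "x \<in> S"
  shows "deriv_on S g x = deriv_on S h x"
proof -
  have "(g has_vector_derivative d) (at x within S) \<longleftrightarrow> (h has_vector_derivative d) (at x within S)"
    for d
    using assms by (intro has_vector_derivative_cong_ev) (auto simp: eventually_at_filter)
  then show ?thesis
    by (simp add: deriv_on_def vector_derivative_def)
qed

lemma higher_deriv_on_0 [simp]: "higher_deriv_on S 0 g = g"
  by (simp add: higher_deriv_on_def)

lemma higher_deriv_on_Suc: "higher_deriv_on S (Suc m) g = deriv_on S (higher_deriv_on S m g)"
  by (simp add: higher_deriv_on_def)

lemma higher_deriv_on_Suc_shift: "higher_deriv_on S (Suc m) g = higher_deriv_on S m (deriv_on S g)"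
  by (simp add: higher_deriv_on_def funpow_swap1)

lemma higher_deriv_on_cong:
  assumes "\<And>x. x \<in> S \<Longrightarrow> g x = h x" "x \<in> S"
  shows "higher_deriv_on S m g x = higher_deriv_on S m h x"
  using assms(2)
proof (induction m arbitrary: x)
  case (Suc m)
  then show ?case unfolding higher_deriv_on_Suc by (intro deriv_on_cong)
qed (simp add: assms(1))

lemma cont_diff_on_cong:
  assumes "\<And>x. x \<in> S \<Longrightarrow> g x = h x"
  shows "cont_diff_on m S g \<longleftrightarrow> cont_diff_on m S h"
proof -
  have eq: "higher_deriv_on S j g x = higher_deriv_on S j h x" if "x \<in> S" for j x
    using higher_deriv_on_cong[OF assms that] .
  have "higher_deriv_on S j g differentiable_on S \<longleftrightarrow> higher_deriv_on S j h differentiable_on S" for j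
    unfolding differentiable_on_def by (metis eq differentiable_transform_within zero_less_one)
  then show ?thesis
    unfolding cont_diff_on_def using continuous_on_cong[OF refl eq, of S "\<lambda>x. x" "\<lambda>_. m"] by simp
qed

lemma cont_diff_on_0 [simp]: "cont_diff_on 0 S g \<longleftrightarrow> continuous_on S g"
  by (simp add: cont_diff_on_def)

text \<open>Here the first derivative is split off, whereas \<open>higher_deriv_on\<close> adds new
  ones at the end. This is the form for inductions on the order in which the function
  varies.\<close>

lemma cont_diff_on_Suc:
  "cont_diff_on (Suc m) S g \<longleftrightarrow> g differentiable_on S \<and> cont_diff_on m S (deriv_on S g)"
  unfolding cont_diff_on_def by (simp add: higher_deriv_on_Suc_shift All_less_Suc2)

lemma differentiable_on_has_deriv_on:
  assumes "g differentiable_on S" "x \<in> S"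
  shows "(g has_real_derivative deriv_on S g x) (at x within S)"
  using assms unfolding deriv_on_def has_real_derivative_iff_has_vector_derivative differentiable_on_def
  by (simp add: vector_derivative_works)

lemma cont_diff_on_SucI:
  assumes "a < b" "\<And>x. x \<in> {a..b} \<Longrightarrow> (g has_real_derivative g' x) (at x within {a..b})"
    and "cont_diff_on m {a..b} g'"
  shows "cont_diff_on (Suc m) {a..b} g"
proof -
  have "cont_diff_on m {a..b} (deriv_on {a..b} g) \<longleftrightarrow> cont_diff_on m {a..b} g'"
    using assms(1,2) by (intro cont_diff_on_cong deriv_on_eq) auto
  then show ?thesis
    using assms(2,3) unfolding cont_diff_on_Suc differentiable_on_def differentiable_def
      has_field_derivative_def by blast
qed

text \<open>The product, quotient and chain rules involve the functions themselves besides their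
  derivatives, so the inductions below need both at the lower order.\<close>

lemma cont_diff_on_SucD:
  assumes "cont_diff_on (Suc m) S g"
  shows "cont_diff_on m S g"
  using assms
proof (induction m arbitrary: g)
  case 0
  then show ?case by (simp add: cont_diff_on_Suc differentiable_imp_continuous_on)
next
  case (Suc m)
  then show ?case by (metis cont_diff_on_Suc)
qed

lemma cont_diff_on_mono:
  assumes "cont_diff_on m S g" "j \<le> m"
  shows "cont_diff_on j S g"
  using assms(2,1) by (induction rule: inc_induct) (auto dest: cont_diff_on_SucD)

lemma cont_diff_on_imp_continuous_on: "cont_diff_on m S g \<Longrightarrow> continuous_on S g"
  using cont_diff_on_mono[of m S g 0] by simp

section \<open>Closure properties of the class C^m\<close>

lemma cont_diff_on_const:
  assumes "a < b"
  shows "cont_diff_on m {a..b} (\<lambda>x. c)"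
proof (induction m arbitrary: c)
  case (Suc m)
  show ?case
    by (rule cont_diff_on_SucI[OF assms _ Suc[of 0]]) auto
qed simp

lemma cont_diff_on_ident:
  assumes "a < b"
  shows "cont_diff_on m {a..b} (\<lambda>x. x)"
proof (cases m)
  case (Suc m')
  show ?thesis unfolding Suc
    by (rule cont_diff_on_SucI[OF assms _ cont_diff_on_const[OF assms, of m' 1]]) auto
qed simp

lemma cont_diff_on_add:
  assumes "a < b" "cont_diff_on m {a..b} g" "cont_diff_on m {a..b} h"
  shows "cont_diff_on m {a..b} (\<lambda>x. g x + h x)"
  using assms(2,3)
proof (induction m arbitrary: g h)
  case 0
  then show ?case by (simp add: continuous_on_add)
next
  case (Suc m)
  then have *: "g differentiable_on {a..b}" "h differentiable_on {a..b}"
      "cont_diff_on m {a..b} (deriv_on {a..b} g)" "cont_diff_on m {a..b} (deriv_on {a..b} h)"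
    by (auto simp: cont_diff_on_Suc)
  show ?case
    by (rule cont_diff_on_SucI[OF assms(1) _ Suc.IH[OF *(3,4)]])
       (intro DERIV_add differentiable_on_has_deriv_on *)
qed

lemma cont_diff_on_mult:
  assumes "a < b" "cont_diff_on m {a..b} g" "cont_diff_on m {a..b} h"
  shows "cont_diff_on m {a..b} (\<lambda>x. g x * h x)"
  using assms(2,3)
proof (induction m arbitrary: g h)
  case 0
  then show ?case by (simp add: continuous_on_mult)
next
  case (Suc m)
  then have *: "g differentiable_on {a..b}" "h differentiable_on {a..b}"
      "cont_diff_on m {a..b} (deriv_on {a..b} g)" "cont_diff_on m {a..b} (deriv_on {a..b} h)"
    by (auto simp: cont_diff_on_Suc)
  have **: "cont_diff_on m {a..b} g" "cont_diff_on m {a..b} h"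
    using Suc.prems by (auto dest: cont_diff_on_SucD)
  have deriv: "((\<lambda>x. g x * h x) has_real_derivative
      deriv_on {a..b} g x * h x + g x * deriv_on {a..b} h x) (at x within {a..b})"
    if "x \<in> {a..b}" for x
    using DERIV_mult[OF differentiable_on_has_deriv_on[OF *(1) that]
        differentiable_on_has_deriv_on[OF *(2) that]]
    by (simp add: mult.commute)
  show ?case
    by (rule cont_diff_on_SucI[OF assms(1) deriv
          cont_diff_on_add[OF assms(1) Suc.IH[OF *(3) **(2)] Suc.IH[OF **(1) *(4)]]])
qed

lemma cont_diff_on_power:
  assumes "a < b" "cont_diff_on m {a..b} g"
  shows "cont_diff_on m {a..b} (\<lambda>x. g x ^ N)"
  by (induction N) (simp_all add: assms cont_diff_on_const cont_diff_on_mult)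

lemma cont_diff_on_inverse:
  assumes "a < b" "cont_diff_on m {a..b} g" "\<And>x. x \<in> {a..b} \<Longrightarrow> g x \<noteq> 0"
  shows "cont_diff_on m {a..b} (\<lambda>x. inverse (g x))"
  using assms(2)
proof (induction m)
  case 0
  then show ?case using assms(3) by (simp add: continuous_on_inverse)
next
  case (Suc m)
  then have *: "g differentiable_on {a..b}" "cont_diff_on m {a..b} (deriv_on {a..b} g)"
    by (auto simp: cont_diff_on_Suc)
  have inv: "cont_diff_on m {a..b} (\<lambda>x. inverse (g x))"
    using Suc by (auto dest: cont_diff_on_SucD)
  have "cont_diff_on m {a..b} (\<lambda>x. (- 1) * (deriv_on {a..b} g x * inverse (g x) ^ 2))"
    by (intro cont_diff_on_mult cont_diff_on_const cont_diff_on_power assms(1) * inv)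
  moreover have "((\<lambda>x. inverse (g x)) has_real_derivative
      (- 1) * (deriv_on {a..b} g x * inverse (g x) ^ 2)) (at x within {a..b})"
    if "x \<in> {a..b}" for x
    using DERIV_inverse_fun[OF differentiable_on_has_deriv_on[OF *(1) that] assms(3)[OF that]]
    by (simp add: power2_eq_square)
  ultimately show ?case
    by (rule cont_diff_on_SucI[OF assms(1), rotated])
qed

lemma cont_diff_on_compose:
  assumes "a < b" "c < d" "cont_diff_on m {c..d} g" "cont_diff_on m {a..b} h"
    and "h \<in> {a..b} \<rightarrow> {c..d}"
  shows "cont_diff_on m {a..b} (\<lambda>x. g (h x))"
  using assms(3,4)
proof (induction m arbitrary: g)
  case 0
  then show ?case using assms(5) by (auto intro!: continuous_on_compose2[of "{c..d}" g])
next
  case (Suc m)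
  then have *: "g differentiable_on {c..d}" "h differentiable_on {a..b}"
      "cont_diff_on m {c..d} (deriv_on {c..d} g)" "cont_diff_on m {a..b} (deriv_on {a..b} h)"
    by (auto simp: cont_diff_on_Suc)
  have h: "cont_diff_on m {a..b} h"
    using Suc.prems by (auto dest: cont_diff_on_SucD)
  have "((\<lambda>x. g (h x)) has_real_derivative deriv_on {c..d} g (h x) * deriv_on {a..b} h x)
      (at x within {a..b})" if "x \<in> {a..b}" for x
  proof -
    \<comment> \<open>The chain rule used here differentiates \<open>g\<close> within the image of
      \<open>h\<close>, which is only a subset of \<open>{c..d}\<close>.\<close>
    have "(g has_real_derivative deriv_on {c..d} g (h x)) (at (h x) within h ` {a..b})"
      using that assms(5) by (intro DERIV_subset[OF differentiable_on_has_deriv_on[OF *(1)]]) auto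
    from DERIV_image_chain[OF this differentiable_on_has_deriv_on[OF *(2) that]]
    show ?thesis by (simp add: o_def)
  qed
  from cont_diff_on_SucI[OF assms(1) this cont_diff_on_mult[OF assms(1) Suc.IH[OF *(3) h] *(4)]]
  show ?case .
qed

text \<open>The derivative of \<open>q\<close> is \<open>inverse (g' (q y))\<close>. This
  bootstraps: once \<open>q\<close> is of class C^j with \<open>j < m\<close>, so is that
  expression, hence \<open>q\<close> is of class C^(j+1).\<close>

lemma cont_diff_on_inverse_function:
  assumes "a < b" "c < d" "cont_diff_on m {a..b} g"
    and deriv: "\<And>x. x \<in> {a..b} \<Longrightarrow> (g has_real_derivative g' x) (at x within {a..b})"
    and nz: "\<And>x. x \<in> {a..b} \<Longrightarrow> g' x \<noteq> 0"
    and img: "g ` {a..b} = {c..d}"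
    and inv: "\<And>x. x \<in> {a..b} \<Longrightarrow> q (g x) = x"
  shows "cont_diff_on m {c..d} q"
proof -
  have contg: "continuous_on {a..b} g"
    using assms(3) by (rule cont_diff_on_imp_continuous_on)
  have contq: "continuous_on {c..d} q"
    using continuous_on_inv[OF contg _ , of q] inv img by simp
  have qmem: "q \<in> {c..d} \<rightarrow> {a..b}"
    unfolding img[symmetric] using inv by auto
  have gq: "g (q y) = y" if "y \<in> {c..d}" for y
    using that inv unfolding img[symmetric] by auto
  have derivq: "(q has_real_derivative inverse (g' (q y))) (at y within {c..d})"
    if y: "y \<in> {c..d}" for y
  proof -
    have x: "q y \<in> {a..b}" using qmem y by auto
    have "(q has_derivative (*) (inverse (g' (q y)))) (at (g (q y)) within g ` {a..b})"
    proof (rule has_derivative_inverse_within)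
      show "(g has_derivative (*) (g' (q y))) (at (q y) within {a..b})"
        using deriv[OF x] by (simp add: has_field_derivative_def)
      show "continuous (at (g (q y)) within g ` {a..b}) q"
        using contq y unfolding img gq[OF y] by (simp add: continuous_on_eq_continuous_within)
      show "(*) (inverse (g' (q y))) \<circ> (*) (g' (q y)) = id"
        using nz[OF x] by (auto simp: fun_eq_iff)
    qed (use x inv in \<open>auto simp: bounded_linear.linear bounded_linear_mult_right\<close>)
    then show ?thesis unfolding img gq[OF y] by (simp add: has_field_derivative_def)
  qed
  have "cont_diff_on j {c..d} q" if "j \<le> m" for j
    using that
  proof (induction j)
    case 0
    then show ?case using contq by simp
  next
    case (Suc j)
    then obtain m' where m': "m = Suc m'" "j \<le> m'" by (cases m) auto
    have "cont_diff_on m' {a..b} (deriv_on {a..b} g)"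
      using assms(3) by (simp add: m' cont_diff_on_Suc)
    moreover have "deriv_on {a..b} g x = g' x" if "x \<in> {a..b}" for x
      using deriv_on_eq[OF assms(1) that deriv[OF that]] .
    ultimately have "cont_diff_on m' {a..b} g'"
      using cont_diff_on_cong by blast
    then have "cont_diff_on j {a..b} g'" using m'(2) by (rule cont_diff_on_mono)
    then have "cont_diff_on j {c..d} (\<lambda>y. g' (q y))"
      by (rule cont_diff_on_compose[OF assms(2,1)]) (use Suc qmem in auto)
    then have "cont_diff_on j {c..d} (\<lambda>y. inverse (g' (q y)))"
      by (rule cont_diff_on_inverse[OF assms(2)]) (use qmem nz in blast)
    from cont_diff_on_SucI[OF assms(2) derivq this] show ?case .
  qed
  then show ?thesis by simp
qed

section \<open>Iterated derivatives of products with a power\<close>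

text \<open>One differentiation turns \<open>q p * p ^ N\<close> into
  \<open>q2 p * p ^ (N - 1)\<close> with \<open>q2 p = q' p * p + N * q p\<close>, at the cost of
  one order of smoothness; at 0 the first term drops out, so the value is multiplied by
  \<open>N\<close>. The factor split off is what cancels the denominator of the bid formula.\<close>

lemma higher_deriv_on_times_power:
  fixes q :: "real \<Rightarrow> real"
  assumes "0 < b" "cont_diff_on m {0..b} q" "m \<le> N"
  obtains r where "continuous_on {0..b} r" "r 0 = fact N / fact (N - m) * q 0"
    "\<And>p. p \<in> {0..b} \<Longrightarrow> higher_deriv_on {0..b} m (\<lambda>p. q p * p ^ N) p = r p * p ^ (N - m)"
proof -
  have "\<exists>r. continuous_on {0..b} r \<and> r 0 = fact N / fact (N - m) * q 0 \<and>
    (\<forall>p\<in>{0..b}. higher_deriv_on {0..b} m (\<lambda>p. q p * p ^ N) p = r p * p ^ (N - m))"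
    using assms(2,3)
  proof (induction m arbitrary: q N)
    case 0
    then show ?case by (intro exI[of _ q]) simp
  next
    case (Suc m)
    obtain N' where N: "N = Suc N'" "m \<le> N'" using Suc.prems(2) by (cases N) auto
    define q' where "q' = deriv_on {0..b} q"
    define q2 where "q2 p = q' p * p + real N * q p" for p
    have "q differentiable_on {0..b}" and q': "cont_diff_on m {0..b} q'"
      using Suc.prems(1) by (auto simp: cont_diff_on_Suc q'_def)
    then have dq: "(q has_real_derivative q' p) (at p within {0..b})" if "p \<in> {0..b}" for p
      using differentiable_on_has_deriv_on[of q, OF _ that] by (simp add: q'_def)
    have deq: "deriv_on {0..b} (\<lambda>p. q p * p ^ N) p = q2 p * p ^ N'" if p: "p \<in> {0..b}" for p
    proof (rule deriv_on_eq[OF assms(1) p])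
      have "((\<lambda>p. p ^ N) has_real_derivative real N * p ^ N') (at p within {0..b})"
        using DERIV_pow[of N p] by (simp add: N)
      from DERIV_mult[OF dq[OF p] this]
      show "((\<lambda>p. q p * p ^ N) has_real_derivative q2 p * p ^ N') (at p within {0..b})"
        by (simp add: q2_def N algebra_simps)
    qed
    have "cont_diff_on m {0..b} q2"
      unfolding q2_def
      by (intro cont_diff_on_add[OF assms(1)] cont_diff_on_mult[OF assms(1)] q'
          cont_diff_on_ident[OF assms(1)] cont_diff_on_const[OF assms(1)]
          cont_diff_on_SucD[OF Suc.prems(1)])
    from Suc.IH[OF this N(2)] obtain r where r: "continuous_on {0..b} r"
      "r 0 = fact N' / fact (N' - m) * q2 0"
      "\<And>p. p \<in> {0..b} \<Longrightarrow> higher_deriv_on {0..b} m (\<lambda>p. q2 p * p ^ N') p = r p * p ^ (N' - m)"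
      by blast
    have "higher_deriv_on {0..b} (Suc m) (\<lambda>p. q p * p ^ N) p = r p * p ^ (N - Suc m)"
      if p: "p \<in> {0..b}" for p
      using higher_deriv_on_cong[OF deq p, where m = m] r(3)[OF p]
      by (simp add: higher_deriv_on_Suc_shift N)
    moreover have "r 0 = fact N / fact (N - Suc m) * q 0"
      using r(2) by (simp add: q2_def N)
    ultimately show ?case using r(1) by blast
  qed
  then show thesis using that by blast
qed

lemma higher_deriv_on_power:
  assumes "a < b" "m \<le> N" "p \<in> {a..b}"
  shows "higher_deriv_on {a..b} m (\<lambda>p. p ^ N) p = fact N / fact (N - m) * p ^ (N - m)"
  using assms(2,3)
proof (induction m arbitrary: p)
  case (Suc m)
  define c :: real where "c = fact N / fact (N - m)"
  have N: "N - m = Suc (N - Suc m)" using Suc.prems(1) by simp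
  have "higher_deriv_on {a..b} (Suc m) (\<lambda>p. p ^ N) p = deriv_on {a..b} (\<lambda>p. c * p ^ (N - m)) p"
    unfolding higher_deriv_on_Suc c_def using Suc by (intro deriv_on_cong) auto
  also have "\<dots> = c * (real (N - m) * p ^ (N - Suc m))"
    using DERIV_cmult[OF DERIV_pow[of "N - m" p], of c] N
    by (intro deriv_on_eq[OF assms(1) Suc.prems(2)]) simp
  also have "\<dots> = fact N / fact (N - Suc m) * p ^ (N - Suc m)"
    unfolding c_def N fact_Suc by simp
  finally show ?case .
qed simp

subsection \<open>Integral equations\<close>

text \<open>The vanishing derivatives at \<open>a\<close> remove the Taylor polynomial, so the
  remainder is all of \<open>g s\<close>.\<close>

lemma Taylor_integral_remainder:
  assumes "a < b" "cont_diff_on (Suc m) {a..b} g" "s \<in> {a..b}"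
    and "\<And>j. j \<le> m \<Longrightarrow> higher_deriv_on {a..b} j g a = 0"
  shows "((\<lambda>p. (s - p) ^ m / fact m * higher_deriv_on {a..b} (Suc m) g p) has_integral g s) {a..s}"
proof -
  have "((\<lambda>p. ((s - p) ^ (Suc m - 1) / fact (Suc m - 1)) *\<^sub>R higher_deriv_on {a..b} (Suc m) g p)
      has_integral g s - (\<Sum>i<Suc m. ((s - a) ^ i / fact i) *\<^sub>R higher_deriv_on {a..b} i g a)) {a..s}"
  proof (rule Taylor_has_integral)
    fix j t assume jt: "j < Suc m" "a \<le> t" "t \<le> s"
    then have "higher_deriv_on {a..b} j g differentiable_on {a..b}"
      using assms(2) by (simp add: cont_diff_on_def)
    from differentiable_on_has_deriv_on[OF this, of t] jt assms(3)
    have "(higher_deriv_on {a..b} j g has_real_derivative higher_deriv_on {a..b} (Suc j) g t)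
        (at t within {a..b})"
      by (simp add: higher_deriv_on_Suc)
    then show "(higher_deriv_on {a..b} j g has_vector_derivative higher_deriv_on {a..b} (Suc j) g t)
        (at t within {a..s})"
      unfolding has_real_derivative_iff_has_vector_derivative[symmetric]
      by (rule DERIV_subset) (use assms(3) in auto)
  qed (use assms(3) in auto)
  then show ?thesis using assms(4) by simp
qed

lemma integral_by_parts_indefinite:
  fixes h w w' :: "real \<Rightarrow> real"
  assumes "a \<le> b" "h integrable_on {a..b}" "bounded (h ` {a..b})"
    and hw: "(\<lambda>y. h y * w y) integrable_on {a..b}"
    and w: "\<And>x. x \<in> {a..b} \<Longrightarrow> (w has_real_derivative w' x) (at x within {a..b})"
    and w': "continuous_on {a..b} w'"
  shows "integral {a..b} (\<lambda>y. h y * w y) =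
    integral {a..b} h * w b - integral {a..b} (\<lambda>y. integral {a..y} h * w' y)"
proof -
  define H where "H x = integral {a..x} h" for x
  define K where "K x = integral {a..x} (\<lambda>y. h y * w y) - H x * w x +
    integral {a..x} (\<lambda>y. H y * w' y)" for x
  have contH: "continuous_on {a..b} H"
    unfolding H_def by (rule indefinite_integral_continuous_1[OF assms(2)])
  obtain B where B: "\<And>y. y \<in> {a..b} \<Longrightarrow> \<bar>h y\<bar> \<le> B"
    using assms(3) unfolding bounded_iff by (metis imageI real_norm_def)
  have "(K has_real_derivative 0) (at x within {a..b})" if x: "x \<in> {a..b}" for x
  proof -
    have contw: "continuous (at x within {a..b}) w"
      using w[OF x] by (rule DERIV_continuous)
    have int: "(\<lambda>y. h y * (w y - w x)) integrable_on {a..b}"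
      using integrable_diff[OF hw integrable_on_mult_left[OF assms(2), of "w x"]]
      by (simp add: algebra_simps)
    \<comment> \<open>Centring makes the integrand tend to 0 at \<open>x\<close>, however
      \<open>h\<close> behaves there, because \<open>h\<close> is bounded; so its indefinite
      integral has derivative 0 at \<open>x\<close>.\<close>
    have lim: "((\<lambda>y. h y * (w y - w x)) \<longlongrightarrow> 0) (at x within {a..b})"
    proof (rule Lim_null_comparison)
      show "eventually (\<lambda>y. norm (h y * (w y - w x)) \<le> B * \<bar>w y - w x\<bar>) (at x within {a..b})"
        unfolding eventually_at_filter
        by (intro always_eventually) (auto simp: abs_mult intro!: mult_right_mono B)
      have "((\<lambda>y. B * \<bar>w y - w x\<bar>) \<longlongrightarrow> B * \<bar>w x - w x\<bar>) (at x within {a..b})"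
        using contw unfolding continuous_within by (intro tendsto_mult tendsto_rabs tendsto_diff tendsto_const)
      then show "((\<lambda>y. B * \<bar>w y - w x\<bar>) \<longlongrightarrow> 0) (at x within {a..b})" by simp
    qed
    have 1: "((\<lambda>u. integral {a..u} (\<lambda>y. h y * (w y - w x))) has_real_derivative 0)
        (at x within {a..b})"
      using integral_has_vector_derivative_continuous_at[OF int, of x "{}"] x lim
      by (simp add: continuous_within has_real_derivative_iff_has_vector_derivative)
    \<comment> \<open>Since the second factor vanishes at \<open>x\<close>, continuity of
      \<open>H\<close> suffices.\<close>
    have 2: "((\<lambda>u. H u * (w u - w x)) has_real_derivative H x * w' x) (at x within {a..b})"
    proof -
      have "((\<lambda>u. H u * ((w u - w x) / (u - x))) \<longlongrightarrow> H x * w' x) (at x within {a..b})"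
        using w[OF x] contH x unfolding has_field_derivative_iff
        by (intro tendsto_mult) (auto simp: continuous_on_def)
      then show ?thesis by (simp add: has_field_derivative_iff)
    qed
    have 3: "((\<lambda>u. integral {a..u} (\<lambda>y. H y * w' y)) has_real_derivative H x * w' x)
        (at x within {a..b})"
      by (rule integral_has_real_derivative[OF continuous_on_mult[OF contH w'] x])
    have eq: "K u = integral {a..u} (\<lambda>y. h y * (w y - w x)) - H u * (w u - w x) +
      integral {a..u} (\<lambda>y. H y * w' y)" if u: "u \<in> {a..b}" for u
    proof -
      have sub: "{a..u} \<subseteq> {a..b}" using u by auto
      have "(\<lambda>y. h y * w y) integrable_on {a..u}" "h integrable_on {a..u}"
        using integrable_on_subinterval[OF hw sub] integrable_on_subinterval[OF assms(2) sub]
        by auto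
      then have "integral {a..u} (\<lambda>y. h y * w y - h y * w x) =
          integral {a..u} (\<lambda>y. h y * w y) - H u * w x"
        by (simp add: integral_diff H_def integrable_on_mult_left)
      then show ?thesis by (simp add: K_def algebra_simps)
    qed
    have "((\<lambda>u. integral {a..u} (\<lambda>y. h y * (w y - w x)) - H u * (w u - w x) +
      integral {a..u} (\<lambda>y. H y * w' y)) has_real_derivative 0 - H x * w' x + H x * w' x)
      (at x within {a..b})"
      by (intro DERIV_add DERIV_diff 1 2 3)
    then show ?thesis
      using has_field_derivative_transform_within[where g = K, OF _ zero_less_one x] eq by simp
  qed
  then obtain c where c: "\<And>x. x \<in> {a..b} \<Longrightarrow> K x = c"
    using has_field_derivative_zero_constant[of "{a..b}" K] by auto
  have "K b = K a" using c assms(1) by simp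
  then show ?thesis by (simp add: K_def H_def)
qed

text \<open>The kernel has order \<open>m\<close>; integration by parts lowers it by one and replaces \<open>h\<close> by the
  continuous function \<open>H * f\<close>, where \<open>H\<close> is the indefinite integral of \<open>h\<close>.\<close>

lemma Volterra_power_kernel_zero:
  fixes h \<phi> f :: "real \<Rightarrow> real"
  assumes "a < b" "h integrable_on {a..b}" "bounded (h ` {a..b})"
    and \<phi>: "\<And>x. x \<in> {a..b} \<Longrightarrow> (\<phi> has_real_derivative f x) (at x within {a..b})"
    and f: "continuous_on {a..b} f" "\<And>x. x \<in> {a..b} \<Longrightarrow> f x \<noteq> 0"
    and "\<And>x. x \<in> {a..b} \<Longrightarrow> ((\<lambda>y. h y * (\<phi> x - \<phi> y) ^ m) has_integral 0) {a..x}"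
    and "x \<in> {a..b}"
  shows "integral {a..x} h = 0"
  using assms(2,3,7,8)
proof (induction m arbitrary: h x)
  case 0
  then show ?case by (simp add: integral_unique)
next
  case (Suc m)
  define H where "H x = integral {a..x} h" for x
  have contH: "continuous_on {a..b} H"
    unfolding H_def by (rule indefinite_integral_continuous_1[OF Suc.prems(1)])
  have contHf: "continuous_on {a..b} (\<lambda>y. H y * f y)"
    by (intro continuous_on_mult contH f)
  have cont\<phi>: "continuous_on {a..b} \<phi>"
    using \<phi> by (rule DERIV_continuous_on)
  have "((\<lambda>y. (H y * f y) * (\<phi> z - \<phi> y) ^ m) has_integral 0) {a..z}" if z: "z \<in> {a..b}" for z
  proof -
    have sub: "{a..z} \<subseteq> {a..b}" using z by auto
    define w where "w y = (\<phi> z - \<phi> y) ^ Suc m" for y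
    define w' where "w' y = - (real (Suc m) * (\<phi> z - \<phi> y) ^ m * f y)" for y
    have "integral {a..z} (\<lambda>y. h y * w y) =
      integral {a..z} h * w z - integral {a..z} (\<lambda>y. integral {a..y} h * w' y)"
    proof (rule integral_by_parts_indefinite)
      show "h integrable_on {a..z}" using integrable_on_subinterval[OF Suc.prems(1) sub] .
      show "bounded (h ` {a..z})" using bounded_subset[OF Suc.prems(2) image_mono[OF sub]] .
      show "(\<lambda>y. h y * w y) integrable_on {a..z}"
        using Suc.prems(3)[OF z] unfolding w_def by (rule has_integral_integrable)
      show "continuous_on {a..z} w'"
        unfolding w'_def
        by (intro continuous_on_mult continuous_on_minus continuous_on_power continuous_on_diff
            continuous_on_const continuous_on_subset[OF cont\<phi> sub] continuous_on_subset[OF f(1) sub])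
      show "(w has_real_derivative w' y) (at y within {a..z})" if "y \<in> {a..z}" for y
      proof -
        have "(\<phi> has_real_derivative f y) (at y within {a..z})"
          using DERIV_subset[OF \<phi> sub] that sub by blast
        from DERIV_power[OF DERIV_diff[OF DERIV_const this], of "\<phi> z" "Suc m"]
        show ?thesis unfolding w_def[abs_def] w'_def by (simp add: algebra_simps)
      qed
    qed (use z in auto)
    moreover have "integral {a..z} (\<lambda>y. h y * w y) = 0"
      using Suc.prems(3)[OF z] unfolding w_def by (rule integral_unique)
    \<comment> \<open>The boundary term disappears because the kernel vanishes on the diagonal; its
      exponent \<open>Suc m\<close> is positive.\<close>
    moreover have "w z = 0" by (simp add: w_def)
    ultimately have "integral {a..z} (\<lambda>y. H y * w' y) = 0" by (simp add: H_def)
    also have "(\<lambda>y. H y * w' y) = (\<lambda>y. - real (Suc m) * ((H y * f y) * (\<phi> z - \<phi> y) ^ m))"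
      by (simp add: w'_def fun_eq_iff algebra_simps)
    also have "integral {a..z} \<dots> =
      - real (Suc m) * integral {a..z} (\<lambda>y. (H y * f y) * (\<phi> z - \<phi> y) ^ m)"
      by (rule integral_mult_right)
    finally have "integral {a..z} (\<lambda>y. (H y * f y) * (\<phi> z - \<phi> y) ^ m) = 0" by simp
    \<comment> \<open>Integrability is needed separately: \<open>integral\<close> is 0 by default on
      functions that are not integrable.\<close>
    moreover have "(\<lambda>y. (H y * f y) * (\<phi> z - \<phi> y) ^ m) integrable_on {a..z}"
      by (intro integrable_continuous_real continuous_on_mult continuous_on_power continuous_on_diff
          continuous_on_const continuous_on_subset[OF contH sub]
          continuous_on_subset[OF cont\<phi> sub] continuous_on_subset[OF f(1) sub])
    ultimately show ?thesis by (metis integrable_integral)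
  qed
  then have zero: "integral {a..z} (\<lambda>y. H y * f y) = 0" if "z \<in> {a..b}" for z
    using that contHf
    by (intro Suc.IH) (auto intro: integrable_continuous_real compact_imp_bounded
        compact_continuous_image)
  \<comment> \<open>Differentiating the vanishing indefinite integral gives
    \<open>H x * f x = 0\<close>, and \<open>f x\<close> is not 0.\<close>
  have "((\<lambda>z. 0) has_real_derivative H x * f x) (at x within {a..b})"
    using has_field_derivative_transform_within[OF integral_has_real_derivative[OF contHf Suc.prems(4)]
        zero_less_one Suc.prems(4)] zero by simp
  then have "deriv_on {a..b} (\<lambda>z. 0) x = H x * f x"
    by (rule deriv_on_eq[OF assms(1) Suc.prems(4)])
  moreover have "deriv_on {a..b} (\<lambda>z. 0) x = 0"
    by (rule deriv_on_eq[OF assms(1) Suc.prems(4)]) simp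
  ultimately show ?case using f(2)[OF Suc.prems(4)] by (simp add: H_def)
qed

subsection \<open>The auction\<close>

lemma increasing_bijection_of_deriv_pos:
  fixes F f :: "real \<Rightarrow> real"
  assumes deriv: "\<And>x. x \<in> {a..b} \<Longrightarrow> (F has_real_derivative f x) (at x within {a..b})"
    and pos: "\<And>x. x \<in> {a..b} \<Longrightarrow> 0 < f x"
    and "a \<le> b"
  shows "strict_mono_on {a..b} F" "F ` {a..b} = {F a..F b}"
proof -
  have cont: "continuous_on {a..b} F"
    using deriv by (rule DERIV_continuous_on)
  show mono: "strict_mono_on {a..b} F"
  proof (rule strict_mono_onI)
    fix x y assume xy: "x \<in> {a..b}" "y \<in> {a..b}" "x < y"
    show "F x < F y"
    proof (rule DERIV_pos_imp_increasing_open[OF xy(3)])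
      fix z assume z: "x < z" "z < y"
      then have "at z within {a..b} = at z"
        using xy by (intro at_within_interior) auto
      then show "\<exists>d. (F has_real_derivative d) (at z) \<and> 0 < d"
        using deriv[of z] pos[of z] z xy by auto
    qed (use xy in \<open>auto intro: continuous_on_subset[OF cont]\<close>)
  qed
  show "F ` {a..b} = {F a..F b}"
  proof
    show "F ` {a..b} \<subseteq> {F a..F b}"
      using mono assms(3) by (auto simp: strict_mono_on_leD)
    show "{F a..F b} \<subseteq> F ` {a..b}"
      using IVT'[of F a _ b] cont assms(3) by force
  qed
qed

text \<open>On \<open>{0..1}\<close> the formula equals \<open>r (F x) / c\<close> with
  \<open>r\<close> continuous, where \<open>r p * p ^ (n - k)\<close> is the derivative of
  \<open>\<gamma>\<close> of order \<open>k - 2\<close>. Both claims are read off from this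
  form.\<close>

lemma bid_formula_eq_continuous:
  assumes k: "3 \<le> k" "k < n" and cd: "cont_diff_on (k - 2) {0..1} F"
    and deriv: "\<And>x. x \<in> {0..1} \<Longrightarrow> (F has_real_derivative f x) (at x within {0..1})"
    and pos: "\<And>x. x \<in> {0..1} \<Longrightarrow> 0 < f x"
    and F01: "F 0 = 0" "F 1 = 1"
  shows "continuous_on {0..1} (bid_formula n k F)" (is ?continuous)
    and "kth_price_equation n k F f (bid_formula n k F)" (is ?equation)
proof -
  define m where "m = k - 3"
  define N where "N = n - 2"
  have km: "k - 2 = Suc m" "k - 3 = m" "N - Suc m = n - k" "Suc m \<le> N" "n - k > 0"
    using k by (auto simp: m_def N_def)
  \<comment> \<open>This is also the coefficient in the derivative of \<open>p ^ N\<close> of order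
    \<open>k - 2\<close>, which lets the two moments be compared.\<close>
  define c :: real where "c = fact (k - 2) * real ((n - 2) choose (k - 2))"
  have c_fact: "c = fact N / fact (N - Suc m)"
    unfolding c_def km(1) N_def[symmetric] using fact_binomial[OF km(4), where 'a = real] .
  have c0: "c \<noteq> 0" unfolding c_fact by simp
  note mono = increasing_bijection_of_deriv_pos(1)[where F = F, OF deriv pos zero_le_one]
  have img: "F ` {0..1} = {0..1}"
    using increasing_bijection_of_deriv_pos(2)[where F = F, OF deriv pos zero_le_one] F01 by simp
  have contF: "continuous_on {0..1} F" using deriv by (rule DERIV_continuous_on)
  have F_mem: "F x \<in> {0..1}" if "x \<in> {0..1}" for x using img that by blast
  define q where "q = quantile F"
  have inv: "q (F x) = x" if "x \<in> {0..1}" for x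
    unfolding q_def quantile_def using strict_mono_on_imp_inj_on[OF mono] that by (rule inv_into_f_f)
  have q0: "q 0 = 0" using inv[of 0] F01 by simp
  have cdq: "cont_diff_on (Suc m) {0..1} q"
    by (rule cont_diff_on_inverse_function[where g = F and g' = f, OF _ _ _ deriv _ img inv])
       (use cd km pos in force)+
  define \<gamma> where "\<gamma> p = q p * p ^ N" for p
  have gamma: "bid_gamma n F = \<gamma>" by (simp add: fun_eq_iff \<gamma>_def bid_gamma_def q_def N_def)
  obtain r where r: "continuous_on {0..1} r" "r 0 = fact N / fact (N - Suc m) * q 0"
      "\<And>p. p \<in> {0..1} \<Longrightarrow> higher_deriv_on {0..1} (Suc m) \<gamma> p = r p * p ^ (N - Suc m)"
    using higher_deriv_on_times_power[OF zero_less_one cdq km(4)] unfolding \<gamma>_def by blast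
  have bid: "bid_formula n k F x = r (F x) / c" if x: "x \<in> {0..1}" for x
  proof (cases "x = 0")
    \<comment> \<open>The quotient 0/0 is 0 in HOL, and \<open>r 0 = 0\<close> because
      \<open>q 0 = 0\<close>.\<close>
    case True
    then show ?thesis using km F01 q0 r(2) by (simp add: bid_formula_def)
  next
    case False
    then have "0 < F x" using strict_mono_onD[OF mono, of 0 x] x F01 by simp
    then show ?thesis
      unfolding bid_formula_def gamma km(1) r(3)[OF F_mem[OF x]]
      by (simp add: c_def km)
  qed
  have "continuous_on {0..1} (\<lambda>x. r (F x) / c)"
    using F_mem c0
    by (intro continuous_on_divide continuous_on_compose2[OF r(1) contF] continuous_on_const) auto
  then show ?continuous
    using bid continuous_on_cong[of "{0..1}" "{0..1}" "bid_formula n k F"] by simp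
  have gamma_int: "((\<lambda>p. (s - p) ^ m / fact m * (r p * p ^ (n - k))) has_integral q s * s ^ N) {0..s}"
    if s: "s \<in> {0..1}" for s
  proof -
    \<comment> \<open>At these orders a positive power \<open>p ^ (N - j)\<close> remains as a
      factor.\<close>
    have "higher_deriv_on {0..1} j \<gamma> 0 = 0" if j: "j \<le> m" for j
    proof -
      have cdj: "cont_diff_on j {0..1} q" and "j \<le> N" "N - j > 0"
        using j km by (auto intro: cont_diff_on_mono[OF cdq])
      then obtain r' where "\<And>p. p \<in> {0..1} \<Longrightarrow> higher_deriv_on {0..1} j \<gamma> p = r' p * p ^ (N - j)"
        using higher_deriv_on_times_power[OF zero_less_one cdj, of N] unfolding \<gamma>_def by blast
      from this[of 0] \<open>N - j > 0\<close> show ?thesis by simp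
    qed
    moreover have "cont_diff_on (Suc m) {0..1} \<gamma>"
      unfolding \<gamma>_def
      by (rule cont_diff_on_mult[OF zero_less_one cdq
            cont_diff_on_power[OF zero_less_one cont_diff_on_ident[OF zero_less_one]]])
    ultimately have "((\<lambda>p. (s - p) ^ m / fact m * higher_deriv_on {0..1} (Suc m) \<gamma> p)
        has_integral \<gamma> s) {0..s}"
      using s by (intro Taylor_integral_remainder) auto
    then have "((\<lambda>p. (s - p) ^ m / fact m * (r p * p ^ (n - k))) has_integral \<gamma> s) {0..s}"
      by (rule has_integral_eq[rotated]) (use r(3) s km(3) in simp)
    then show ?thesis by (simp add: \<gamma>_def)
  qed
  have power_int: "((\<lambda>p. (s - p) ^ m / fact m * (c * p ^ (n - k))) has_integral s ^ N) {0..s}"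
    if s: "s \<in> {0..1}" for s
  proof -
    have "((\<lambda>p. (s - p) ^ m / fact m * higher_deriv_on {0..1} (Suc m) (\<lambda>p. p ^ N) p)
        has_integral s ^ N) {0..s}"
    proof (rule Taylor_integral_remainder)
      show "cont_diff_on (Suc m) {0..1} (\<lambda>p. p ^ N)"
        by (rule cont_diff_on_power[OF zero_less_one cont_diff_on_ident[OF zero_less_one]])
      show "higher_deriv_on {0..1} j (\<lambda>p. p ^ N) 0 = 0" if "j \<le> m" for j
        using that km(4) higher_deriv_on_power[of 0 1 j N 0] by simp
    qed (use s in auto)
    then show ?thesis
      by (rule has_integral_eq[rotated])
         (use s in \<open>simp add: higher_deriv_on_power[OF zero_less_one km(4)] c_fact km(3)\<close>)
  qed
  show ?equation
    unfolding kth_price_equation_def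
  proof
    fix x :: real assume x: "x \<in> {0..1}"
    define s where "s = F x"
    have s: "s \<in> {0..1}" using F_mem x by (simp add: s_def)
    \<comment> \<open>After the substitution \<open>p = F y\<close>, this is the integrand of the
      equation times \<open>c / fact m\<close>. The two moments computed above make its integral
      \<open>x * s ^ N - q s * s ^ N\<close>, which is 0 as \<open>q s = x\<close>.\<close>
    define e where "e p = x * ((s - p) ^ m / fact m * (c * p ^ (n - k))) -
      (s - p) ^ m / fact m * (r p * p ^ (n - k))" for p
    have "(e has_integral x * s ^ N - q s * s ^ N) {0..s}"
      unfolding e_def[abs_def]
      by (rule has_integral_diff[OF has_integral_mult_right[OF power_int[OF s]] gamma_int[OF s]])
    moreover have "q s = x" using inv x by (simp add: s_def)
    ultimately have e0: "integral {0..s} e = 0" by (simp add: integral_unique)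
    have conte: "continuous_on {0..1} e"
      unfolding e_def[abs_def]
      by (intro continuous_on_diff continuous_on_mult continuous_on_divide continuous_on_power
          continuous_on_const continuous_on_id r(1)) simp_all
    have derivx: "(F has_real_derivative f y) (at y within {0..x})" if "y \<in> {0..x}" for y
      using DERIV_subset[OF deriv[of y], of "{0..x}"] that x by simp
    have "F ` {0..x} \<subseteq> {0..1}" by (intro image_subsetI F_mem) (use x in auto)
    moreover have "0 \<le> x" "F 0 \<le> F x" using x s F01 by (auto simp: s_def)
    ultimately have "((\<lambda>y. f y *\<^sub>R e (F y)) has_integral integral {F 0..F x} e) {0..x}"
      using has_integral_substitution[of 0 x F 0 1 e f] conte derivx by blast
    then have "((\<lambda>y. f y * e (F y)) has_integral 0) {0..x}"
      using e0 F01 by (simp add: s_def)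
    from has_integral_mult_right[OF this, of "fact m / c"]
    have "((\<lambda>y. fact m / c * (f y * e (F y))) has_integral 0) {0..x}" by simp
    then show "((\<lambda>y. (x - bid_formula n k F y) * F y ^ (n - k) * (F x - F y) ^ (k - 3) * f y)
        has_integral 0) {0..x}"
    proof (rule has_integral_eq[rotated])
      fix y assume y: "y \<in> {0..x}"
      then have "y \<in> {0..1}" using x by simp
      from bid[OF this]
      show "fact m / c * (f y * e (F y)) =
          (x - bid_formula n k F y) * F y ^ (n - k) * (F x - F y) ^ (k - 3) * f y"
        using c0 unfolding e_def km(2) s_def by (simp add: algebra_simps)
    qed
  qed
qed

text \<open>The points where the two solutions agree are dense. Approaching \<open>x\<close> through
  them from the right bounds \<open>\<beta> x\<close> above, from the left below; hence equality
  inside, but only one inequality at each end.\<close>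

lemma kth_price_solutions_agree:
  assumes \<beta>: "strict_mono_on {0..1} \<beta>" and eq\<beta>: "kth_price_equation n k F f \<beta>"
    and b: "continuous_on {0..1} b" and eqb: "kth_price_equation n k F f b"
    and deriv: "\<And>x. x \<in> {0..1} \<Longrightarrow> (F has_real_derivative f x) (at x within {0..1})"
    and f: "continuous_on {0..1} f" "\<And>x. x \<in> {0..1} \<Longrightarrow> 0 < f x"
    and F0: "F 0 = 0"
  shows "\<And>x. 0 \<le> x \<Longrightarrow> x < 1 \<Longrightarrow> \<beta> x \<le> b x"
    and "\<And>x. 0 < x \<Longrightarrow> x \<le> 1 \<Longrightarrow> b x \<le> \<beta> x"
proof -
  note mono = increasing_bijection_of_deriv_pos(1)[where F = F, OF deriv f(2) zero_le_one]
  have contF: "continuous_on {0..1} F" using deriv by (rule DERIV_continuous_on)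
  have mono\<beta>: "mono_on {0..1} \<beta>" using \<beta> by (rule strict_mono_on_imp_mono_on)
  have "\<beta> ` {0..1} \<subseteq> {\<beta> 0..\<beta> 1}"
    using mono\<beta> by (auto intro!: mono_onD[OF mono\<beta>])
  then have bdd\<beta>: "bounded (\<beta> ` {0..1})" using bounded_closed_interval bounded_subset by blast
  define w where "w y = F y ^ (n - k) * f y" for y
  have w: "continuous_on {0..1} w"
    unfolding w_def by (intro continuous_on_mult continuous_on_power contF f)
  define h where "h y = (\<beta> y - b y) * w y" for y
  have bdd: "bounded (g ` {0..1})" if "continuous_on {0..1} g" for g :: "real \<Rightarrow> real"
    using that by (intro compact_imp_bounded compact_continuous_image) auto
  have "bounded ((\<lambda>y. \<beta> y - b y) ` {0..1})"
    using bdd\<beta> bdd[OF b] by (rule bounded_minus_comp)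
  moreover note bdd[OF w]
  ultimately obtain A B where "\<bar>\<beta> y - b y\<bar> \<le> A" "\<bar>w y\<bar> \<le> B" if "y \<in> {0..1}" for y
    unfolding bounded_iff by (metis imageI real_norm_def)
  then have "\<bar>h y\<bar> \<le> A * B" if "y \<in> {0..1}" for y
    unfolding h_def abs_mult using that by (meson abs_ge_zero mult_mono order_trans)
  then have bddh: "bounded (h ` {0..1})"
    unfolding bounded_iff by (intro exI[of _ "A * B"]) auto
  \<comment> \<open>Monotonicity supplies measurability, so the product with the continuous weight
    \<open>w\<close> is integrable although \<open>\<beta>\<close> may jump.\<close>
  have "\<beta> \<in> borel_measurable (lebesgue_on {0..1})"
    using integrable_mono_on[OF mono\<beta>] by (rule borel_measurable_integrable)
  then have "(\<lambda>y. \<beta> y * w y) integrable_on {0..1}"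
    using bdd\<beta> absolutely_integrable_continuous_real[OF w]
    by (intro set_lebesgue_integral_eq_integral(1)
        absolutely_integrable_bounded_measurable_product_real) auto
  moreover have "(\<lambda>y. b y * w y) integrable_on {0..1}"
    by (intro integrable_continuous_real continuous_on_mult b w)
  ultimately have inth: "h integrable_on {0..1}"
    unfolding h_def[abs_def] left_diff_distrib by (rule integrable_diff)
  have "((\<lambda>y. h y * (F x - F y) ^ (k - 3)) has_integral 0) {0..x}" if x: "x \<in> {0..1}" for x
  proof -
    have "((\<lambda>y. (x - b y) * F y ^ (n - k) * (F x - F y) ^ (k - 3) * f y -
        (x - \<beta> y) * F y ^ (n - k) * (F x - F y) ^ (k - 3) * f y) has_integral 0 - 0) {0..x}"
      using eq\<beta> eqb x unfolding kth_price_equation_def by (intro has_integral_diff) auto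
    then show ?thesis by (simp add: h_def w_def algebra_simps)
  qed
  then have zero: "integral {0..x} h = 0" if "x \<in> {0..1}" for x
    using Volterra_power_kernel_zero[OF zero_less_one inth bddh deriv f(1) less_imp_neq[OF f(2), symmetric]]
      that by blast
  define D where "D = {x \<in> {0..1}. \<not> continuous (at x within {0..1}) \<beta>}"
  have D: "countable D" unfolding D_def by (rule mono_on_ctble_discont[OF mono\<beta>])
  \<comment> \<open>At a continuity point the indefinite integral of \<open>h\<close>, which is 0,
    has derivative \<open>h x\<close>. Positivity of \<open>x\<close> makes \<open>F x\<close>, and
    with it the weight \<open>w x\<close>, positive, so the weight can be cancelled.\<close>
  have eq: "\<beta> x = b x" if x: "0 < x" "x \<le> 1" "x \<notin> D" for x
  proof -
    have x01: "x \<in> {0..1}" using x by simp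
    have "continuous (at x within {0..1}) h"
      unfolding h_def[abs_def]
      using x b w x01
      by (intro continuous_mult continuous_diff) (auto simp: D_def continuous_on_eq_continuous_within)
    then have "((\<lambda>u. integral {0..u} h) has_real_derivative h x) (at x within {0..1})"
      using integral_has_vector_derivative_continuous_at[OF inth, of x "{}"] x01
      by (simp add: has_real_derivative_iff_has_vector_derivative)
    then have "((\<lambda>u. 0) has_real_derivative h x) (at x within {0..1})"
      using has_field_derivative_transform_within[OF _ zero_less_one x01] zero by fastforce
    then have "deriv_on {0..1} (\<lambda>u. 0) x = h x"
      by (rule deriv_on_eq[OF zero_less_one x01])
    moreover have "deriv_on {0..1} (\<lambda>u. 0) x = 0"
      by (rule deriv_on_eq[OF zero_less_one x01]) simp
    moreover have "F x > 0" using strict_mono_onD[OF mono, of 0 x] x F0 by simp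
    then have "w x > 0" using f(2)[OF x01] by (simp add: w_def)
    ultimately show ?thesis by (simp add: h_def)
  qed
  have dense: "\<exists>y. u < y \<and> y < v \<and> \<beta> y = b y" if "0 \<le> u" "u < v" "v \<le> 1" for u v
  proof -
    \<comment> \<open>A countable set contains no open interval.\<close>
    have "\<not> {u<..<v} \<subseteq> D"
      using that(2) D countable_subset uncountable_open_interval by blast
    then obtain y where y: "u < y" "y < v" "y \<notin> D" by (auto simp: subset_eq)
    with eq[of y] that show ?thesis by auto
  qed
  have near: "\<exists>d>0. \<forall>y\<in>{0..1}. \<bar>y - x\<bar> < d \<longrightarrow> \<bar>b y - b x\<bar> < \<epsilon>" if "x \<in> {0..1}" "\<epsilon> > 0" for x \<epsilon>
    using b that unfolding continuous_on_iff dist_real_def by blast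
  show "\<beta> x \<le> b x" if x: "0 \<le> x" "x < 1" for x
  proof (rule ccontr)
    assume "\<not> \<beta> x \<le> b x"
    then have "x \<in> {0..1}" "0 < \<beta> x - b x" using x by auto
    \<comment> \<open>To the right of \<open>x\<close>, \<open>b\<close> stays below
      \<open>\<beta> x\<close> for a while, yet at an agreement point \<open>y\<close> there
      \<open>b y = \<beta> y \<ge> \<beta> x\<close>.\<close>
    from near[OF this] obtain d where d: "d > 0"
      "\<forall>y\<in>{0..1}. \<bar>y - x\<bar> < d \<longrightarrow> \<bar>b y - b x\<bar> < \<beta> x - b x" by blast
    obtain y where y: "x < y" "y < min 1 (x + d)" "\<beta> y = b y"
      using dense[of x "min 1 (x + d)"] x d(1) by auto
    then have "\<bar>b y - b x\<bar> < \<beta> x - b x" using d(2) x by auto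
    moreover have "\<beta> x \<le> \<beta> y" using mono_onD[OF mono\<beta>, of x y] x y by auto
    ultimately show False using y(3) by linarith
  qed
  show "b x \<le> \<beta> x" if x: "0 < x" "x \<le> 1" for x
  proof (rule ccontr)
    assume "\<not> b x \<le> \<beta> x"
    then have "x \<in> {0..1}" "0 < b x - \<beta> x" using x by auto
    from near[OF this] obtain d where d: "d > 0"
      "\<forall>y\<in>{0..1}. \<bar>y - x\<bar> < d \<longrightarrow> \<bar>b y - b x\<bar> < b x - \<beta> x" by blast
    obtain y where y: "max 0 (x - d) < y" "y < x" "\<beta> y = b y"
      using dense[of "max 0 (x - d)" x] x d(1) by auto
    then have "\<bar>b y - b x\<bar> < b x - \<beta> x" using d(2) x by auto
    moreover have "\<beta> y \<le> \<beta> x" using mono_onD[OF mono\<beta>, of y x] x y by auto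
    ultimately show False using y(3) by linarith
  qed
qed

theorem theorem3p1:
  fixes M :: "'a measure" and X :: "'a \<Rightarrow> real" and F f :: "real \<Rightarrow> real" and n k :: nat
  assumes "3 \<le> k" and "k < n"
    and "prob_space M"
    and "X \<in> borel_measurable M"
    and "\<And>\<omega>. \<omega> \<in> space M \<Longrightarrow> X \<omega> \<in> {0..1}"
    and "F = cdf (distr M borel X)"
    and "cont_diff_on (k - 2) {0..1} F"
    and "\<And>x. x \<in> {0..1} \<Longrightarrow> (F has_real_derivative f x) (at x within {0..1})"
    and "distributed M lborel X (\<lambda>x. ennreal (f x) * indicator {0..1} x)"
    and "\<And>x. x \<in> {0..1} \<Longrightarrow> f x > 0"
  shows "kth_price_equation n k F f (bid_formula n k F) \<and>
    (\<forall>\<beta>. admissible_bid M X \<beta> \<longrightarrow>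
       (kth_price_equation n k F f \<beta> \<longleftrightarrow> (\<forall>x\<in>{0..1}. \<beta> x = bid_formula n k F x)))"
proof -
  interpret prob_space M by fact
  note [measurable] = assms(4)
  note deriv = assms(8) and pos = assms(10)
  have F: "F x = prob {\<omega> \<in> space M. X \<omega> \<le> x}" for x
    unfolding assms(6) cdf_def by (subst measure_distr) (auto intro!: arg_cong[where f = prob])
  \<comment> \<open>A law with a density has no atoms. This gives \<open>F 0 = 0\<close>, and later
    makes the event \<open>X = 1\<close> negligible.\<close>
  have point: "prob {\<omega> \<in> space M. X \<omega> = x} = 0" for x
  proof -
    have "emeasure M (X -` {x} \<inter> space M) =
        (\<integral>\<^sup>+y. ennreal (f y) * indicator {0..1} y * indicator {x} y \<partial>lborel)"
      by (rule distributed_emeasure[OF assms(9)]) simp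
    also have "\<dots> = 0"
      using distributed_borel_measurable[OF assms(9)]
      by (intro nn_integral_0_iff_AE[THEN iffD2])
         (use AE_lborel_singleton[of x] in \<open>auto elim!: eventually_mono\<close>)
    also have "X -` {x} \<inter> space M = {\<omega> \<in> space M. X \<omega> = x}" by auto
    finally show ?thesis by (simp add: measure_def)
  qed
  have "F 0 = prob {\<omega> \<in> space M. X \<omega> = 0}"
    unfolding F using assms(5) by (intro arg_cong[where f = prob]) force
  then have F0: "F 0 = 0" using point by simp
  have "{\<omega> \<in> space M. X \<omega> \<le> 1} = space M" using assms(5) by auto
  then have F1: "F 1 = 1" unfolding F by (simp add: prob_space)
  define b where "b = bid_formula n k F"
  note bid = bid_formula_eq_continuous[OF assms(1,2,7) deriv pos F0 F1, folded b_def]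
  have b0: "b 0 = 0" using assms(2) F0 by (simp add: b_def bid_formula_def)
  have contf: "continuous_on {0..1} f"
  proof -
    \<comment> \<open>From \<open>k \<ge> 3\<close>, at least one continuous derivative of
      \<open>F\<close> is available, and it is \<open>f\<close>.\<close>
    obtain m where m: "k - 2 = Suc m" using assms(1) by (cases "k - 2") auto
    have "continuous_on {0..1} (deriv_on {0..1} F)"
      using assms(7) unfolding m cont_diff_on_Suc by (blast intro: cont_diff_on_imp_continuous_on)
    moreover have "deriv_on {0..1} F x = f x" if "x \<in> {0..1}" for x
      by (rule deriv_on_eq[OF zero_less_one that deriv[OF that]])
    ultimately show ?thesis
      using continuous_on_cong[of "{0..1}" "{0..1}" "deriv_on {0..1} F" f] by simp
  qed
  have "kth_price_equation n k F f \<beta> \<longleftrightarrow> (\<forall>x\<in>{0..1}. \<beta> x = b x)" if adm: "admissible_bid M X \<beta>" for \<beta>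
  proof
    assume eq: "\<forall>x\<in>{0..1}. \<beta> x = b x"
    show "kth_price_equation n k F f \<beta>"
      unfolding kth_price_equation_def
    proof
      fix x :: real assume x: "x \<in> {0..1}"
      have "((\<lambda>y. (x - b y) * F y ^ (n - k) * (F x - F y) ^ (k - 3) * f y) has_integral 0) {0..x}"
        using bid(2) x unfolding kth_price_equation_def by blast
      then show "((\<lambda>y. (x - \<beta> y) * F y ^ (n - k) * (F x - F y) ^ (k - 3) * f y) has_integral 0) {0..x}"
        by (rule has_integral_eq[rotated]) (use eq x in simp)
    qed
  next
    assume eq: "kth_price_equation n k F f \<beta>"
    have nonneg: "\<beta> \<in> {0..1} \<rightarrow> {0..}" and mono: "strict_mono_on {0..1} \<beta>"
      and cdf_mono: "strict_mono_on {\<beta> 0..\<beta> 1} (cdf (distr M borel (\<lambda>\<omega>. \<beta> (X \<omega>))))"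
      and meas: "(\<lambda>\<omega>. \<beta> (X \<omega>)) \<in> borel_measurable M"
      using adm unfolding admissible_bid_def by (auto dest: distributed_measurable)
    note agree = kth_price_solutions_agree[OF mono eq bid deriv contf pos F0]
    have "\<beta> 0 = b 0" using agree(1)[of 0] nonneg b0 by force
    moreover have "\<beta> 1 = b 1"
      \<comment> \<open>If \<open>b 1 < \<beta> 1\<close>, no bid except that of the null event \<open>X = 1\<close> exceeds \<open>b 1\<close>, so the
        distribution function of the bids is constant on \<open>{b 1..\<beta> 1}\<close>.\<close>
    proof (rule ccontr)
      assume "\<beta> 1 \<noteq> b 1"
      then have less: "b 1 < \<beta> 1" using agree(2)[of 1] by simp
      \<comment> \<open>For \<open>y\<close> between \<open>x\<close> and 1,
        \<open>\<beta> x < \<beta> y \<le> b y\<close>; now let \<open>y\<close> tend to 1.\<close>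
      have le: "\<beta> x \<le> b 1" if x: "0 \<le> x" "x < 1" for x
      proof (rule tendsto_lowerbound)
        have "(b \<longlongrightarrow> b 1) (at 1 within {0..1})"
          using bid(1) by (simp add: continuous_on_def)
        then show "(b \<longlongrightarrow> b 1) (at_left 1)"
          by (simp add: at_within_Icc_at_left)
        have "eventually (\<lambda>y. y \<in> {x<..<1}) (at_left 1)"
          using x by (intro eventually_at_left_real) auto
        then show "eventually (\<lambda>y. \<beta> x \<le> b y) (at_left 1)"
        proof eventually_elim
          case (elim y)
          have "\<beta> x < \<beta> y" using strict_mono_onD[OF mono, of x y] elim x by auto
          also have "\<beta> y \<le> b y" using agree(1)[of y] elim x by auto
          finally show ?case by simp
        qed
      qed simp
      have cdf: "cdf (distr M borel (\<lambda>\<omega>. \<beta> (X \<omega>))) y = prob {\<omega> \<in> space M. \<beta> (X \<omega>) \<le> y}" for y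
        unfolding cdf_def using meas
        by (subst measure_distr) (auto intro!: arg_cong[where f = prob])
      have "prob {\<omega> \<in> space M. X \<omega> \<noteq> 1} = 1"
        using prob_neg[of "\<lambda>\<omega>. X \<omega> = 1"] point[of 1] by simp
      moreover have "{\<omega> \<in> space M. X \<omega> \<noteq> 1} \<subseteq> {\<omega> \<in> space M. \<beta> (X \<omega>) \<le> b 1}"
        using le assms(5) by force
      then have "prob {\<omega> \<in> space M. X \<omega> \<noteq> 1} \<le> prob {\<omega> \<in> space M. \<beta> (X \<omega>) \<le> b 1}"
        using meas by (intro finite_measure_mono) auto
      \<comment> \<open>The bound \<open>le\<close> at 0 places \<open>b 1\<close> in
        \<open>{\<beta> 0..\<beta> 1}\<close>, where strict monotonicity applies. But the smaller
        value is already 1.\<close>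
      moreover have "cdf (distr M borel (\<lambda>\<omega>. \<beta> (X \<omega>))) (b 1) < cdf (distr M borel (\<lambda>\<omega>. \<beta> (X \<omega>))) (\<beta> 1)"
        using strict_mono_onD[OF cdf_mono, of "b 1" "\<beta> 1"] less le[of 0] by auto
      moreover have "prob {\<omega> \<in> space M. \<beta> (X \<omega>) \<le> \<beta> 1} \<le> 1" by simp
      ultimately show False unfolding cdf by linarith
    qed
    ultimately show "\<forall>x\<in>{0..1}. \<beta> x = b x"
      using agree by (metis antisym_conv atLeastAtMost_iff less_eq_real_def)
  qed
  then show ?thesis using bid(2) unfolding b_def by blast
qed

end
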